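(* Let $g=([n],E)$ be a hypergraph, let $t\in[n]$, and let $g_t$ be the $t$-adjacent subhypergraph of $g$. Then: (i) $\mathrm{ran}(g_t)=0$ if and only if $E_2^t(|g\rangle)=0$. (ii) If $\mathrm{ran}(g_t)=1$, then $E_2^t(|g\rangle)=\frac14$, that is, qubit $t$ is maximally entangled with the other $n-1$ qubits. (iii) If $\mathrm{ran}(g_t)=n-1$, then $0<E_2^t(|g\rangle)<\frac14$.
   Context: For a positive integer $n$, $[n]=\{1,2,\dots,n\}$. A hypergraph is a pair $(V,E)$ with $V$ a finite set of vertices and $E\subseteq\wp(V)$ (the power set of $V$) a set of hyperedges; the empty hyperedge $\varnothing$ and one-element hyperedges are allowed. The rank $\mathrm{ran}(g)$ of a hypergraph $g$ is the maximum cardinality of a hyperedge of $g$, with the convention that the rank is $0$ if there are no hyperedges. For $t\in V$, the $t$-adjacent subhypergraph of $g=(V,E)$ is $g_t=(V_t,E_t)$ with $V_t=V\setminus\{t\}$ and $E_t=\{e\setminus\{t\}: e\in E,\ t\in e\}$. The hypergraph state of $g=([n],E)$ is $|g\rangle=\frac{1}{\sqrt{2^n}}\sum_{x\in\{0,1\}^n}(-1)^{u(g)(x)}|x_1\rangle\otimes\cdots\otimes|x_n\rangle\in(\mathbb{C}^2)^{\otimes n}$, where $u(g)(x)=\bigoplus_{e\in E}\prod_{k\in e}x_k$, $\oplus$ is addition modulo 2 and the empty product equals $1$. For an $n$-qubit pure state (unit vector) $|\phi\rangle$, the local entropic measure on qubit $t$ is $E_2^t(|\phi\rangle)=\det(\rho_t)$,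 where $\rho_t=\mathrm{Tr}_{\text{all but }t}(|\phi\rangle\langle\phi|)$ is the $2\times2$ reduced density matrix obtained by tracing out all qubits except $t$. It always satisfies $0\le E_2^t(|\phi\rangle)\le\frac14$, and maximal entanglement of qubit $t$ with the others means $E_2^t(|\phi\rangle)=\frac14$.
   Formalization: Part (iii) is stated for n ≥ 3 only: for n = 1 the rank n−1 is 0, so (i) gives entropy 0, and for n = 2 the rank n−1 is 1, so (ii) gives entropy 1/4; hence (iii) fails in every case with n ≤ 2. *)

theory Defs
  imports Complex_Main "HOL-Library.FuncSet" "Jordan_Normal_Form.Determinant"
begin

section \<open>Hypergraphs\<close>

type_synonym 'a hypergraph = "'a set \<times> 'a set set"

abbreviation verts :: "'a hypergraph \<Rightarrow> 'a set" where "verts g \<equiv> fst g"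
abbreviation hedges :: "'a hypergraph \<Rightarrow> 'a set set" where "hedges g \<equiv> snd g"

definition hypergraph :: "'a hypergraph \<Rightarrow> bool" where
  "hypergraph g \<longleftrightarrow> finite (verts g) \<and> hedges g \<subseteq> Pow (verts g)"

definition hyper_rank :: "'a hypergraph \<Rightarrow> nat" where
  "hyper_rank g = (if hedges g = {} then 0 else Max (card ` hedges g))"

definition adjacent_sub :: "'a \<Rightarrow> 'a hypergraph \<Rightarrow> 'a hypergraph" where
  "adjacent_sub t g = (verts g - {t}, {e - {t} | e. e \<in> hedges g \<and> t \<in> e})"

section \<open>Multi-qubit states\<close>

text \<open>
  Qubits are labelled by the elements of a finite set \<open>V\<close>. The set \<open>bits V\<close> of bit assignments
  labels the computational basis of the tensor product of copies of \<open>\<complex>\<^sup>2\<close> over \<open>V\<close>. A vector of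
  that space is represented by its family of amplitudes, and an operator by its matrix entries,
  with respect to this basis. A single-qubit vector is a \<^typ>\<open>complex vec\<close> of dimension 2.
\<close>

definition bits :: "'a set \<Rightarrow> ('a \<Rightarrow> nat) set" where
  "bits V = V \<rightarrow>\<^sub>E {0, 1}"

type_synonym 'a qstate = "('a \<Rightarrow> nat) \<Rightarrow> complex"
type_synonym 'a qoperator = "('a \<Rightarrow> nat) \<Rightarrow> ('a \<Rightarrow> nat) \<Rightarrow> complex"

definition ket :: "nat \<Rightarrow> complex vec" where
  "ket b = unit_vec 2 b"

definition tensor :: "'a set \<Rightarrow> ('a \<Rightarrow> complex vec) \<Rightarrow> 'a qstate" where
  "tensor V v = (\<lambda>y \<in> bits V. \<Prod>k\<in>V. v k $ y k)"

definition parity_fun :: "'a hypergraph \<Rightarrow> ('a \<Rightarrow> nat) \<Rightarrow> nat" where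
  "parity_fun g x = (\<Sum>e\<in>hedges g. \<Prod>k\<in>e. x k) mod 2"

definition hypergraph_state :: "'a hypergraph \<Rightarrow> 'a qstate" where
  "hypergraph_state g = (\<lambda>y \<in> bits (verts g).
     complex_of_real (1 / sqrt (2 ^ card (verts g))) *
       (\<Sum>x\<in>bits (verts g). (-1) ^ parity_fun g x * tensor (verts g) (\<lambda>k. ket (x k)) y))"

section \<open>The local entropic measure\<close>

definition density :: "'a qstate \<Rightarrow> 'a qoperator" where
  "density \<phi> = (\<lambda>x y. \<phi> x * cnj (\<phi> y))"

text \<open>
  Trace over all qubits except \<open>t\<close>; \<open>z\<close> runs over the basis labels of the traced-out qubits and
  \<open>z(t := a)\<close> is the label that extends \<open>z\<close> by the bit \<open>a\<close> at \<open>t\<close>.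
\<close>

definition partial_trace_except :: "'a set \<Rightarrow> 'a \<Rightarrow> 'a qoperator \<Rightarrow> complex mat" where
  "partial_trace_except V t \<rho> =
     mat 2 2 (\<lambda>(a, b). \<Sum>z\<in>bits (V - {t}). \<rho> (z(t := a)) (z(t := b)))"

definition reduced_density :: "'a set \<Rightarrow> 'a \<Rightarrow> 'a qstate \<Rightarrow> complex mat" where
  "reduced_density V t \<phi> = partial_trace_except V t (density \<phi>)"

text \<open>
  The determinant of the reduced density matrix is always real, as
  \<open>of_real_local_entropy\<close> shows, so taking the real part only changes the type.
\<close>

definition local_entropy :: "'a set \<Rightarrow> 'a \<Rightarrow> 'a qstate \<Rightarrow> real" where
  "local_entropy V t \<phi> = Re (det (reduced_density V t \<phi>))"

lemma det_mat_2:
  fixes A :: "'a :: comm_ring_1 mat"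
  assumes "A \<in> carrier_mat 2 2"
  shows "det A = A $$ (0, 0) * A $$ (1, 1) - A $$ (0, 1) * A $$ (1, 0)"
proof -
  have "det A = (\<Sum>i<2. A $$ (i, 0) * cofactor A i 0)"
    by (rule laplace_expansion_column[OF assms]) simp
  also have "\<dots> = A $$ (0, 0) * cofactor A 0 0 + A $$ (1, 0) * cofactor A 1 0"
    by (simp add: numeral_2_eq_2)
  also have "cofactor A 0 0 = A $$ (1, 1)"
    using assms by (simp add: cofactor_def mat_delete_def det_single)
  also have "cofactor A 1 0 = - A $$ (0, 1)"
    using assms by (simp add: cofactor_def mat_delete_def det_single)
  finally show ?thesis
    by (simp add: mult.commute)
qed

lemma of_real_local_entropy:
  "complex_of_real (local_entropy V t \<phi>) = det (reduced_density V t \<phi>)"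
proof -
  let ?R = "reduced_density V t \<phi>"
  have car: "?R \<in> carrier_mat 2 2"
    by (simp add: reduced_density_def partial_trace_except_def)
  have herm: "cnj (?R $$ (a, b)) = ?R $$ (b, a)" if "a < 2" "b < 2" for a b
    using that by (simp add: reduced_density_def partial_trace_except_def density_def mult.commute)
  have "cnj (det ?R) = det ?R"
    by (simp add: det_mat_2[OF car] herm mult.commute)
  then show ?thesis
    by (simp add: local_entropy_def complex_eq_iff)
qed

end

theory Submission
  imports Defs
begin

text \<open>
  Expanding the reduced density matrix gives
  \<open>E\<^sub>2\<^sup>t(|g\<rangle>) = 1/4 - (S / 2^n)\<^sup>2\<close>, where \<open>S\<close> is the sum of the signs \<open>(-1)^u(g\<^sub>t)(z)\<close> over
  all bit assignments \<open>z\<close> of the remaining \<open>n - 1\<close> qubits.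
  Part (i) says that \<open>|S| = 2^(n-1)\<close> exactly if \<open>u(g\<^sub>t)\<close> is constant; a minimal nonempty edge
  of \<open>g\<^sub>t\<close> witnesses that it is not.
  In part (ii), flipping a bit \<open>k\<close> with \<open>{k}\<close> an edge of \<open>g\<^sub>t\<close> reverses every sign, so \<open>S = 0\<close>.
  In part (iii), the full set is an edge of \<open>g\<^sub>t\<close>, which makes the number of negative signs odd,
  while \<open>S = 0\<close> would make it equal to the even number \<open>2^(n-2)\<close>.
\<close>

section \<open>Bit assignments on a finite vertex set\<close>

lemma finite_bits: "finite V \<Longrightarrow> finite (bits V)"
  by (simp add: bits_def finite_PiE)

lemma card_bits: "finite V \<Longrightarrow> card (bits V) = 2 ^ card V"
  by (simp add: bits_def card_PiE numeral_2_eq_2)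

lemma bits_upd: "z \<in> bits (V - {t}) \<Longrightarrow> t \<in> V \<Longrightarrow> a \<in> {0, 1} \<Longrightarrow> z(t := a) \<in> bits V"
  by (fastforce simp: bits_def PiE_iff extensional_def)

text \<open>Identifying an assignment with its support turns sums over basis labels into sums over
  power sets, where edges can be compared with supports by inclusion.\<close>

lemma bij_betw_bits_Pow: "bij_betw (\<lambda>x. {k \<in> V. x k = 1}) (bits V) (Pow V)"
proof (rule bij_betwI[where g = "\<lambda>A. restrict (\<lambda>k. if k \<in> A then 1 else 0) V"])
  fix x assume "x \<in> bits V"
  then show "restrict (\<lambda>k. if k \<in> {k \<in> V. x k = 1} then 1 else 0) V = x"
    by (fastforce simp: bits_def PiE_iff extensional_def fun_eq_iff)
qed (auto simp: bits_def)

section \<open>Sign sums over subsets\<close>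

text \<open>For the edge set of a hypergraph and the support \<open>A\<close> of an assignment, this
  is the sign of that assignment in the hypergraph state. An empty edge counts for every
  \<open>A\<close>, so it only contributes a global factor \<open>-1\<close>.\<close>

definition subset_sign :: "'a set set \<Rightarrow> 'a set \<Rightarrow> real" where
  "subset_sign F A = (-1) ^ card {e \<in> F. e \<subseteq> A}"

definition sign_sum :: "'a set \<Rightarrow> 'a set set \<Rightarrow> real" where
  "sign_sum W F = (\<Sum>A\<in>Pow W. subset_sign F A)"

lemma subset_sign_cases: "subset_sign F A = 1 \<or> subset_sign F A = -1"
  by (simp add: subset_sign_def) (metis neg_one_even_power neg_one_odd_power)

lemma subset_sign_square: "subset_sign F A * subset_sign F A = 1"
  using subset_sign_cases[of F A] by auto

text \<open>Two different signs mean that both \<open>1\<close> and \<open>-1\<close> occur, so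
  termwise comparison with the constants \<open>1\<close> and \<open>-1\<close> is strict on both
  sides.\<close>

lemma abs_sum_signs_less:
  fixes s :: "'b \<Rightarrow> real"
  assumes "finite X" and s: "\<And>x. x \<in> X \<Longrightarrow> s x = 1 \<or> s x = -1"
    and "a \<in> X" "b \<in> X" "s a \<noteq> s b"
  shows "\<bar>sum s X\<bar> < card X"
proof -
  have "\<exists>x\<in>X. s x = 1" "\<exists>x\<in>X. s x = -1"
    using assms by metis+
  then have "sum s X < (\<Sum>x\<in>X. 1)" "(\<Sum>x\<in>X. - 1) < sum s X"
    using s \<open>finite X\<close> by (intro sum_strict_mono_ex1; force)+
  then show ?thesis by simp
qed

lemma abs_sign_sum_le: "finite W \<Longrightarrow> \<bar>sign_sum W F\<bar> \<le> 2 ^ card W"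
proof -
  assume "finite W"
  have "\<bar>sign_sum W F\<bar> \<le> (\<Sum>A\<in>Pow W. \<bar>subset_sign F A\<bar>)"
    unfolding sign_sum_def by (rule sum_abs)
  also have "\<dots> = 2 ^ card W"
    using \<open>finite W\<close> by (simp add: subset_sign_def power_abs card_Pow)
  finally show ?thesis .
qed

text \<open>The extreme value is reached only if no two signs cancel, that is, if the sign is
  constant in \<open>A\<close>.\<close>

lemma abs_sign_sum_eq_iff:
  assumes W: "finite W" and F: "F \<subseteq> Pow W"
  shows "\<bar>sign_sum W F\<bar> = 2 ^ card W \<longleftrightarrow> F \<subseteq> {{}}"
proof
  assume "F \<subseteq> {{}}"
  then have "{e \<in> F. e \<subseteq> A} = F" for A by auto
  then show "\<bar>sign_sum W F\<bar> = 2 ^ card W"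
    using W by (simp add: sign_sum_def subset_sign_def abs_mult power_abs card_Pow)
next
  assume eq: "\<bar>sign_sum W F\<bar> = 2 ^ card W"
  show "F \<subseteq> {{}}"
  proof (rule ccontr)
    assume "\<not> F \<subseteq> {{}}"
    then obtain e0 where "e0 \<in> F" "e0 \<noteq> {}" by auto
    \<comment> \<open>A nonempty edge of least size contains no other nonempty edge. Passing from
      \<open>{}\<close> to \<open>e\<close> therefore gains exactly one edge, which flips the
      sign.\<close>
    then obtain e where e: "e \<in> F" "e \<noteq> {}"
      and min: "\<And>d. d \<in> F \<Longrightarrow> d \<noteq> {} \<Longrightarrow> card e \<le> card d"
      using ex_has_least_nat[of "\<lambda>e. e \<in> F \<and> e \<noteq> {}" e0 card] by auto
    have fin: "finite e" "finite F"
      using e F W by (auto intro: finite_subset[OF _ W] finite_subset[of F "Pow W"])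
    have "d = e" if "d \<in> F" "d \<noteq> {}" "d \<subseteq> e" for d
      using that min[of d] fin by (simp add: card_subset_eq card_mono le_antisym)
    then have "{d \<in> F. d \<subseteq> e} = insert e {d \<in> F. d \<subseteq> {}}"
      using e by auto
    then have "card {d \<in> F. d \<subseteq> e} = Suc (card {d \<in> F. d \<subseteq> {}})"
      using e fin by (simp add: card_insert_if)
    then have "subset_sign F e = - subset_sign F {}"
      by (simp add: subset_sign_def)
    then have "subset_sign F {} \<noteq> subset_sign F e"
      using subset_sign_cases[of F "{}"] by auto
    moreover have "e \<in> Pow W" using e F by auto
    ultimately have "\<bar>sign_sum W F\<bar> < card (Pow W)"
      unfolding sign_sum_def using W
      by (intro abs_sum_signs_less subset_sign_cases) auto
    then show False using eq W by (simp add: card_Pow)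
  qed
qed

text \<open>As edges have at most one element, adding \<open>k\<close> to a set without
  \<open>k\<close> gains the edge \<open>{k}\<close> and nothing else. Pairing \<open>A\<close> with
  \<open>insert k A\<close> then cancels all terms.\<close>

lemma sign_sum_singletons:
  assumes W: "finite W" and F: "F \<subseteq> Pow W" and le1: "\<And>e. e \<in> F \<Longrightarrow> card e \<le> 1"
    and k: "{k} \<in> F"
  shows "sign_sum W F = 0"
proof -
  have kW: "k \<in> W" using k F by auto
  have finF: "finite F" using F W by (auto intro: finite_subset)
  have flip: "subset_sign F (insert k A) = - subset_sign F A" if "A \<subseteq> W - {k}" for A
  proof -
    have "e \<subseteq> A \<or> e = {k}" if "e \<in> F" "e \<subseteq> insert k A" for e
    proof -
      have "finite e" using that F W by (auto intro: finite_subset)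
      then have "e = {} \<or> (\<exists>x. e = {x})"
        using le1[OF that(1)] by (metis card_0_eq card_1_singletonE le_neq_implies_less less_one)
      then show ?thesis using that by auto
    qed
    then have "{e \<in> F. e \<subseteq> insert k A} = insert {k} {e \<in> F. e \<subseteq> A}"
      using k by auto
    moreover have "{k} \<notin> {e \<in> F. e \<subseteq> A}" using that by auto
    ultimately show ?thesis using finF by (simp add: subset_sign_def)
  qed
  have "Pow W = Pow (W - {k}) \<union> insert k ` Pow (W - {k})"
    using kW Pow_insert[of k "W - {k}"] by (simp add: insert_absorb)
  then have "sign_sum W F =
      (\<Sum>A\<in>Pow (W - {k}). subset_sign F A) + (\<Sum>A\<in>insert k ` Pow (W - {k}). subset_sign F A)"
    unfolding sign_sum_def using W by (auto intro!: sum.union_disjoint)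
  also have "(\<Sum>A\<in>insert k ` Pow (W - {k}). subset_sign F A)
      = (\<Sum>A\<in>Pow (W - {k}). subset_sign F (insert k A))"
    by (rule sum.reindex_cong[of "insert k"]) (auto simp: inj_on_def)
  also have "\<dots> = - (\<Sum>A\<in>Pow (W - {k}). subset_sign F A)"
    using flip by (simp add: sum_negf)
  finally show ?thesis by simp
qed

text \<open>The number of negative signs is computed modulo 2 in two ways. The size bound matters:
  for a single vertex and \<open>F = {W}\<close> the two signs cancel.\<close>

lemma sign_sum_full_edge:
  assumes W: "finite W" and F: "F \<subseteq> Pow W" and "W \<in> F" and two: "2 \<le> card W"
  shows "sign_sum W F \<noteq> 0"
proof
  assume zero: "sign_sum W F = 0"
  define c where "c A = card {e \<in> F. e \<subseteq> A}" for A
  define N where "N = {A \<in> Pow W. odd (c A)}"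
  have finF: "finite F" using F W by (auto intro: finite_subset)
  have finN: "finite N" using W by (simp add: N_def)
  \<comment> \<open>A sign is \<open>1\<close> minus twice the indicator of an odd exponent, so a
    vanishing sum forces \<open>card N\<close> to be half of \<open>2 ^ card W\<close>.\<close>
  have "sign_sum W F = (\<Sum>A\<in>Pow W. 1 - 2 * of_bool (odd (c A)))"
    unfolding sign_sum_def subset_sign_def c_def by (intro sum.cong) auto
  also have "\<dots> = 2 ^ card W - 2 * (\<Sum>A\<in>Pow W. of_bool (odd (c A)))"
    using W by (simp add: sum_subtractf card_Pow sum_distrib_left)
  also have "(\<Sum>A\<in>Pow W. of_bool (odd (c A))) = real (card N)"
    using W by (simp add: N_def of_bool_def sum.If_cases Int_def)
  finally have "2 ^ card W = 2 * real (card N)"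
    using zero by simp
  then have "real (2 ^ card W) = real (2 * card N)" by simp
  then have "2 ^ card W = 2 * card N" unfolding of_nat_eq_iff .
  moreover obtain m where "card W = Suc (Suc m)"
    using two by (metis Suc_le_D numeral_2_eq_2 Suc_le_mono)
  ultimately have "card N = 2 * 2 ^ m" by simp
  then have evenN: "even (card N)" by simp
  \<comment> \<open>The parity of \<open>card N\<close> is that of the sum of all
    \<open>c A\<close>. Double counting the pairs \<open>e \<subseteq> A\<close> helps here: an edge
    has \<open>2 ^ (card W - card e)\<close> supersets in \<open>W\<close>, an odd number only for
    \<open>e = W\<close>.\<close>
  have "(\<Sum>A\<in>Pow W. c A) = (\<Sum>A\<in>Pow W. \<Sum>e\<in>F. of_bool (e \<subseteq> A))"
    using finF by (simp add: c_def of_bool_def sum.If_cases Int_def)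
  also have "\<dots> = (\<Sum>e\<in>F. \<Sum>A\<in>Pow W. of_bool (e \<subseteq> A))"
    by (rule sum.swap)
  also have "\<dots> = (\<Sum>e\<in>F. 2 ^ (card W - card e))"
  proof (rule sum.cong)
    fix e assume "e \<in> F"
    then have e: "e \<subseteq> W" "finite e" using F W by (auto intro: finite_subset)
    have "(\<Sum>A\<in>Pow W. of_bool (e \<subseteq> A)) = card {A \<in> Pow W. e \<subseteq> A}"
      using W by (simp add: of_bool_def sum.If_cases Int_def)
    also have "bij_betw (\<lambda>B. B \<union> e) (Pow (W - e)) {A \<in> Pow W. e \<subseteq> A}"
      by (rule bij_betwI[where g = "\<lambda>A. A - e"]) (use e in auto)
    then have "card {A \<in> Pow W. e \<subseteq> A} = card (Pow (W - e))"
      by (simp add: bij_betw_same_card)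
    also have "\<dots> = 2 ^ (card W - card e)"
      using e W by (simp add: card_Pow card_Diff_subset)
    finally show "(\<Sum>A\<in>Pow W. of_bool (e \<subseteq> A)) = (2::nat) ^ (card W - card e)" .
  qed simp
  also have "\<dots> = 1 + (\<Sum>e\<in>F - {W}. 2 ^ (card W - card e))"
    using \<open>W \<in> F\<close> finF by (simp add: sum.remove)
  finally have eq: "(\<Sum>A\<in>Pow W. c A) = 1 + (\<Sum>e\<in>F - {W}. 2 ^ (card W - card e))" .
  have "even (\<Sum>e\<in>F - {W}. (2::nat) ^ (card W - card e))"
  proof (rule dvd_sum)
    fix e assume "e \<in> F - {W}"
    then have "card e < card W" using F W by (intro psubset_card_mono) auto
    then show "even ((2::nat) ^ (card W - card e))" by simp
  qed
  then have "odd (\<Sum>A\<in>Pow W. c A)" by (simp add: eq)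
  then have "odd (card N)"
    using W by (simp add: N_def even_sum_iff)
  with evenN show False by simp
qed

section \<open>Hypergraph states\<close>

lemma tensor_ket:
  assumes "finite V" "x \<in> bits V" "y \<in> bits V"
  shows "tensor V (\<lambda>k. ket (x k)) y = of_bool (x = y)"
proof -
  have bit: "x k < 2" "y k < 2" if "k \<in> V" for k
    using assms that by (auto simp: bits_def PiE_iff less_2_cases_iff)
  have "tensor V (\<lambda>k. ket (x k)) y = (\<Prod>k\<in>V. of_bool (x k = y k))"
    using assms bit by (auto simp: tensor_def ket_def unit_vec_def intro!: prod.cong)
  also have "\<dots> = of_bool (\<forall>k\<in>V. x k = y k)"
    using \<open>finite V\<close> by (induction V rule: finite_induct) auto
  \<comment> \<open>Both assignments take the same default value outside \<open>V\<close>, so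
    agreement on \<open>V\<close> is equality.\<close>
  also have "(\<forall>k\<in>V. x k = y k) \<longleftrightarrow> x = y"
    using assms by (auto simp: bits_def intro: PiE_ext)
  finally show ?thesis .
qed

text \<open>A product of bits over an edge is \<open>1\<close> exactly if the edge lies in the
  support, and reduction modulo 2 does not affect a power of \<open>-1\<close>.\<close>

lemma parity_fun_sign:
  assumes g: "hypergraph g" and x: "x \<in> bits (verts g)"
  shows "(-1) ^ parity_fun g x = complex_of_real (subset_sign (hedges g) {k \<in> verts g. x k = 1})"
proof -
  let ?A = "{k \<in> verts g. x k = 1}"
  have fin: "finite (verts g)" and sub: "hedges g \<subseteq> Pow (verts g)"
    using g by (auto simp: hypergraph_def)
  then have finE: "finite (hedges g)" by (auto intro: finite_subset)
  have "(\<Prod>k\<in>e. x k) = of_bool (e \<subseteq> ?A)" if "e \<in> hedges g" for e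
  proof -
    have e: "e \<subseteq> verts g" "finite e" using that sub fin by (auto intro: finite_subset)
    have bit: "x k = 0 \<or> x k = 1" if "k \<in> e" for k
      using that e x by (auto simp: bits_def PiE_iff)
    show ?thesis
    proof (cases "e \<subseteq> ?A")
      case True
      then have "(\<Prod>k\<in>e. x k) = 1" by (intro prod.neutral) auto
      with True show ?thesis by simp
    next
      case False
      then obtain k where "k \<in> e" "x k = 0" using bit e by auto
      then show ?thesis using e False by auto
    qed
  qed
  then have "(\<Sum>e\<in>hedges g. \<Prod>k\<in>e. x k) = card {e \<in> hedges g. e \<subseteq> ?A}"
    using finE by (simp add: of_bool_def sum.If_cases Int_def)
  then show ?thesis
    by (simp add: parity_fun_def subset_sign_def minus_one_power_iff)
qed

lemma hypergraph_state_amplitude: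
  assumes g: "hypergraph g" and y: "y \<in> bits (verts g)"
  shows "hypergraph_state g y = complex_of_real
    (subset_sign (hedges g) {k \<in> verts g. y k = 1} / sqrt (2 ^ card (verts g)))"
proof -
  have fin: "finite (verts g)" using g by (simp add: hypergraph_def)
  have "(\<Sum>x\<in>bits (verts g). (-1) ^ parity_fun g x * tensor (verts g) (\<lambda>k. ket (x k)) y)
      = (\<Sum>x\<in>bits (verts g). if x = y then (-1) ^ parity_fun g x else (0::complex))"
    using fin y by (intro sum.cong) (auto simp: tensor_ket)
  also have "\<dots> = (-1) ^ parity_fun g y"
    using fin y by (simp add: finite_bits)
  finally show ?thesis
    using g y by (simp add: hypergraph_state_def parity_fun_sign)
qed

lemma hypergraph_adjacent_sub: "hypergraph g \<Longrightarrow> hypergraph (adjacent_sub t g)"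
  by (auto simp: hypergraph_def adjacent_sub_def)

text \<open>This is where the adjacent subhypergraph enters: the edges gained by adding
  \<open>t\<close> are those through \<open>t\<close>, and deleting \<open>t\<close> maps them
  injectively onto the edges of \<open>adjacent_sub t g\<close> inside \<open>A\<close>.\<close>

lemma subset_sign_insert:
  assumes "finite (hedges g)" and "t \<notin> A"
  shows "subset_sign (hedges g) (insert t A)
    = subset_sign (hedges g) A * subset_sign (hedges (adjacent_sub t g)) A"
proof -
  let ?E = "hedges g"
  let ?B = "{e \<in> ?E. t \<in> e \<and> e - {t} \<subseteq> A}"
  have "{e \<in> ?E. e \<subseteq> insert t A} = {e \<in> ?E. e \<subseteq> A} \<union> ?B"
    by auto
  moreover have "{e \<in> ?E. e \<subseteq> A} \<inter> ?B = {}"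
    using assms by auto
  ultimately have "card {e \<in> ?E. e \<subseteq> insert t A} = card {e \<in> ?E. e \<subseteq> A} + card ?B"
    using assms by (simp add: card_Un_disjoint)
  moreover have "{e \<in> hedges (adjacent_sub t g). e \<subseteq> A} = (\<lambda>e. e - {t}) ` ?B"
    by (auto simp: adjacent_sub_def)
  moreover have "inj_on (\<lambda>e. e - {t}) ?B"
    by (auto simp: inj_on_def)
  ultimately show ?thesis
    by (simp add: subset_sign_def power_add card_image)
qed

text \<open>Signs square to \<open>1\<close>, so both diagonal entries of the reduced matrix are
  \<open>1/2\<close>. Off the diagonal the sign of \<open>g\<close> cancels and only that of
  \<open>adjacent_sub t g\<close> remains to be summed.\<close>

lemma local_entropy_hypergraph_state:
  assumes g: "hypergraph g" and t: "t \<in> verts g"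
  shows "local_entropy (verts g) t (hypergraph_state g)
    = 1/4 - (sign_sum (verts g - {t}) (hedges (adjacent_sub t g)) / 2 ^ card (verts g))\<^sup>2"
proof -
  define V where "V = verts g"
  define E where "E = hedges g"
  define F where "F = hedges (adjacent_sub t g)"
  define W where "W = V - {t}"
  define S where "S z = {k \<in> W. z k = 1}" for z :: "'a \<Rightarrow> nat"
  let ?R = "reduced_density V t (hypergraph_state g)"
  let ?N = "(2::real) ^ card V"
  have fin: "finite V" "finite W"
    using g by (simp_all add: hypergraph_def V_def W_def)
  have finE: "finite E"
    using g by (auto simp: hypergraph_def E_def intro: finite_subset)
  have cV: "card V = Suc (card W)"
    using t fin card.remove[of V t] by (simp add: V_def W_def)
  have amp0: "hypergraph_state g (z(t := 0)) = complex_of_real (subset_sign E (S z) / sqrt ?N)"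
    if "z \<in> bits W" for z
  proof -
    have "{k \<in> V. (z(t := 0)) k = 1} = S z" by (auto simp: S_def W_def)
    moreover have "z(t := 0) \<in> bits V" using that t by (auto simp: W_def V_def intro!: bits_upd)
    ultimately show ?thesis using g by (simp add: hypergraph_state_amplitude V_def E_def)
  qed
  have amp1: "hypergraph_state g (z(t := 1))
      = complex_of_real (subset_sign E (S z) * subset_sign F (S z) / sqrt ?N)"
    if "z \<in> bits W" for z
  proof -
    have "{k \<in> V. (z(t := 1)) k = 1} = insert t (S z)"
      using t by (auto simp: S_def W_def V_def)
    moreover have "z(t := 1) \<in> bits V" using that t by (auto simp: W_def V_def intro!: bits_upd)
    moreover have "t \<notin> S z" by (simp add: S_def W_def)
    ultimately show ?thesis
      using g finE by (simp add: hypergraph_state_amplitude subset_sign_insert V_def E_def F_def)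
  qed
  have entry: "?R $$ (a, b) = (\<Sum>z\<in>bits W.
      hypergraph_state g (z(t := a)) * cnj (hypergraph_state g (z(t := b))))"
    if "a < 2" "b < 2" for a b
    using that by (simp add: reduced_density_def partial_trace_except_def density_def W_def)
  have sq: "complex_of_real (sqrt ?N) * complex_of_real (sqrt ?N) = of_real ?N"
    by (simp flip: of_real_mult)
  have sgn: "complex_of_real (subset_sign G A) * of_real (subset_sign G A) = 1" for G :: "'a set set" and A
    by (simp add: subset_sign_square flip: of_real_mult)
  \<comment> \<open>The same cancellation inside a longer product, the shape that arises once
    factors are sorted.\<close>
  have sgn': "complex_of_real (subset_sign G A) * (of_real (subset_sign G A) * c) = c"
    for G :: "'a set set" and A and c
    by (simp add: sgn flip: mult.assoc)
  have "?R $$ (0, 0) = 2 ^ card W / of_real ?N" "?R $$ (1, 1) = 2 ^ card W / of_real ?N"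
    using fin by (simp_all add: entry amp0 amp1[simplified] sq sgn sgn' card_bits mult_ac)
  then have diag: "?R $$ (0, 0) = 1 / 2" "?R $$ (1, 1) = 1 / 2"
    by (simp_all add: cV)
  have "(\<Sum>z\<in>bits W. complex_of_real (subset_sign F (S z))) = of_real (sign_sum W F)"
    using sum.reindex_bij_betw[OF bij_betw_bits_Pow[of W], of "\<lambda>A. complex_of_real (subset_sign F A)"]
    by (simp add: S_def sign_sum_def)
  then have off: "?R $$ (0, 1) = of_real (sign_sum W F / ?N)" "?R $$ (1, 0) = of_real (sign_sum W F / ?N)"
    using fin by (simp_all add: entry amp0 amp1[simplified] sq sgn sgn' mult_ac flip: sum_divide_distrib)
  have "?R \<in> carrier_mat 2 2"
    by (simp add: reduced_density_def partial_trace_except_def)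
  from det_mat_2[OF this] have "det ?R = of_real (1/4 - (sign_sum W F / ?N)\<^sup>2)"
    unfolding diag off by (simp add: power2_eq_square)
  then show ?thesis
    unfolding local_entropy_def V_def W_def F_def by (metis Re_complex_of_real)
qed

section \<open>The rank as an attained maximum\<close>

lemma card_le_hyper_rank:
  assumes "hypergraph g" "e \<in> hedges g"
  shows "card e \<le> hyper_rank g"
proof -
  have "finite (hedges g)" using assms by (auto simp: hypergraph_def intro: finite_subset)
  then show ?thesis using assms by (auto simp: hyper_rank_def)
qed

lemma hyper_rank_attained:
  assumes "hypergraph g" "hyper_rank g \<noteq> 0"
  obtains e where "e \<in> hedges g" "card e = hyper_rank g"
proof -
  have "finite (hedges g)" using assms by (auto simp: hypergraph_def intro: finite_subset)
  moreover have "hedges g \<noteq> {}" using assms by (auto simp: hyper_rank_def)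
  ultimately have "hyper_rank g \<in> card ` hedges g"
    by (simp add: hyper_rank_def)
  then show thesis using that by auto
qed

text \<open>Rank \<open>0\<close> covers two situations: no edges, by convention, and the empty edge
  alone.\<close>

lemma hyper_rank_eq_0_iff:
  assumes "hypergraph g"
  shows "hyper_rank g = 0 \<longleftrightarrow> hedges g \<subseteq> {{}}"
proof
  assume 0: "hyper_rank g = 0"
  show "hedges g \<subseteq> {{}}"
  proof
    fix e assume e: "e \<in> hedges g"
    then have "finite e" using assms by (auto simp: hypergraph_def intro: finite_subset)
    then show "e \<in> {{}}" using card_le_hyper_rank[OF assms e] 0 by simp
  qed
next
  assume "hedges g \<subseteq> {{}}"
  then show "hyper_rank g = 0"
    by (metis assms card.empty hyper_rank_attained singletonD subsetD)
qed

theorem proposition5: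
  fixes n t :: nat and g :: "nat hypergraph"
  assumes "hypergraph g" and "verts g = {1..n}" and "t \<in> {1..n}"
  shows "(hyper_rank (adjacent_sub t g) = 0
            \<longleftrightarrow> local_entropy {1..n} t (hypergraph_state g) = 0) \<and>
         (hyper_rank (adjacent_sub t g) = 1
            \<longrightarrow> local_entropy {1..n} t (hypergraph_state g) = 1 / 4) \<and>
         (n \<ge> 3 \<and> hyper_rank (adjacent_sub t g) = n - 1
            \<longrightarrow> 0 < local_entropy {1..n} t (hypergraph_state g) \<and>
                local_entropy {1..n} t (hypergraph_state g) < 1 / 4)"
proof -
  let ?h = "adjacent_sub t g"
  let ?ent = "local_entropy {1..n} t (hypergraph_state g)"
  define W where "W = {1..n} - {t}"
  define F where "F = hedges ?h"
  \<comment> \<open>Taking the absolute value places \<open>r\<close> between \<open>0\<close> and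
    \<open>1/2\<close>, where it is determined by its square.\<close>
  define r where "r = \<bar>sign_sum W F\<bar> / 2 ^ n"
  have h: "hypergraph ?h" by (rule hypergraph_adjacent_sub) fact
  have W: "finite W" and cW: "card W = n - 1" and n: "n \<ge> 1"
    using assms by (auto simp: W_def)
  have F: "F \<subseteq> Pow W"
    using h assms by (simp add: hypergraph_def F_def W_def adjacent_sub_def)
  have ent: "?ent = 1/4 - r\<^sup>2"
    using local_entropy_hypergraph_state[of g t] assms
    by (simp add: W_def F_def r_def power_divide)
  have two: "(2::real) ^ n = 2 * 2 ^ card W"
    using n by (simp add: cW flip: power_Suc)
  have r0: "0 \<le> r" and r_le: "r \<le> 1/2"
    using abs_sign_sum_le[OF W, of F] by (simp_all add: r_def two field_simps)
  have "?ent = 0 \<longleftrightarrow> r\<^sup>2 = (1/2)\<^sup>2"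
    unfolding ent by (auto simp: power2_eq_square)
  also have "\<dots> \<longleftrightarrow> r = 1/2"
    using r0 by (subst power2_eq_iff_nonneg) auto
  also have "\<dots> \<longleftrightarrow> \<bar>sign_sum W F\<bar> = 2 ^ card W"
    by (auto simp: r_def two field_simps)
  also have "\<dots> \<longleftrightarrow> hyper_rank ?h = 0"
    using abs_sign_sum_eq_iff[OF W F] hyper_rank_eq_0_iff[OF h] by (simp add: F_def)
  finally have i: "?ent = 0 \<longleftrightarrow> hyper_rank ?h = 0" .
  have ii: "?ent = 1/4" if rank: "hyper_rank ?h = 1"
  proof -
    obtain e where "e \<in> F" "card e = 1"
      using hyper_rank_attained[OF h] rank by (metis F_def zero_neq_one)
    then obtain k where "{k} \<in> F" by (metis card_1_singletonE)
    moreover have "card e \<le> 1" if "e \<in> F" for e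
      using card_le_hyper_rank[OF h] that rank by (metis F_def)
    ultimately have "sign_sum W F = 0"
      using sign_sum_singletons[OF W F] by blast
    then show ?thesis unfolding ent by (simp add: r_def)
  qed
  \<comment> \<open>For \<open>n = 1\<close> and \<open>n = 2\<close> the rank \<open>n - 1\<close>
    is \<open>0\<close> or \<open>1\<close>, and the first two parts give the excluded values
    \<open>0\<close> and \<open>1/4\<close>.\<close>
  have iii: "0 < ?ent \<and> ?ent < 1/4" if "n \<ge> 3" and rank: "hyper_rank ?h = n - 1"
  proof
    have "r\<^sup>2 \<le> (1/2)\<^sup>2"
      using r0 r_le by (intro power_mono)
    then have "0 \<le> ?ent" unfolding ent by (simp add: power2_eq_square)
    moreover have "?ent \<noteq> 0" using i that by simp
    ultimately show "0 < ?ent" by simp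
    have "hyper_rank ?h \<noteq> 0" using that by simp
    \<comment> \<open>An edge attaining the rank has as many elements as \<open>W\<close>, so it is
      \<open>W\<close> itself.\<close>
    then obtain e where "e \<in> F" "card e = card W"
      using hyper_rank_attained[OF h] rank cW by (metis F_def)
    then have "W \<in> F" using F W by (metis PowD card_subset_eq subsetD)
    then have "sign_sum W F \<noteq> 0"
      using that cW by (intro sign_sum_full_edge W F) auto
    then show "?ent < 1/4" unfolding ent by (simp add: r_def)
  qed
  show ?thesis using i ii iii by blast
qed

end
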